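(* Let $G$ be a group acting by automorphisms on a simplicial poset $P$. Then the quotient $P/G$ is a simplicial poset if and only if the action of $G$ on $P$ is translative.
   Context: A simplicial poset is a countable poset $P$ of finite length (the length is the maximum of $|C|-1$ over chains $C\subseteq P$) with a unique minimal element $\hat 0$ such that for every $p\in P$ the lower interval $P_{\leq p}=\{x\in P\mid x\leq p\}$ is a Boolean algebra, i.e. isomorphic to the poset of all subsets of $\{1,\dots,n\}$ ordered by inclusion, for some $n\in\mathbb N$. An action of a group $G$ on a poset $P$ is a group homomorphism from $G$ to the group of order automorphisms of $P$. The quotient $P/G$ is the set of orbits with the relation $Gp\leq Gq$ if and only if $gp\leq q$ for some $g\in G$ (for posets of finite length this is a partial order). The action is translative if, for all $p\in P$ and $g\in G$, whenever the set $\{p,gp\}$ has an upper bound in $P$, then $p=gp$. *)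

theory Defs
  imports "HOL-Algebra.Group_Action" "HOL-Library.Countable_Set"
begin

text \<open>
  A poset is a carrier set \<open>A\<close> with a relation \<open>r\<close> such that \<^const>\<open>partial_order_on\<close> holds;
  \<open>(x, y) \<in> r\<close> is read as \<open>x \<le> y\<close>. Since \<^const>\<open>partial_order_on\<close> includes
  \<open>r \<subseteq> A \<times> A\<close>, every member of \<open>Chains r\<close> is a subset of \<open>A\<close>.
\<close>

definition order_iso ::
  "'a set \<Rightarrow> ('a \<times> 'a) set \<Rightarrow> 'b set \<Rightarrow> ('b \<times> 'b) set \<Rightarrow> ('a \<Rightarrow> 'b) \<Rightarrow> bool"
  where "order_iso A r B s f \<longleftrightarrow>
    bij_betw f A B \<and> (\<forall>x\<in>A. \<forall>y\<in>A. (x, y) \<in> r \<longleftrightarrow> (f x, f y) \<in> s)"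

definition has_finite_length :: "('a \<times> 'a) set \<Rightarrow> bool"
  where "has_finite_length r \<longleftrightarrow> (\<exists>l. \<forall>C\<in>Chains r. finite C \<and> card C \<le> l + 1)"

definition minimal_in :: "'a set \<Rightarrow> ('a \<times> 'a) set \<Rightarrow> 'a \<Rightarrow> bool"
  where "minimal_in A r m \<longleftrightarrow> m \<in> A \<and> (\<forall>x\<in>A. (x, m) \<in> r \<longrightarrow> x = m)"

definition boolean_poset :: "'a set \<Rightarrow> ('a \<times> 'a) set \<Rightarrow> bool"
  where "boolean_poset A r \<longleftrightarrow>
    (\<exists>(n::nat) f. order_iso A r (Pow {1..n}) (relation_of (\<subseteq>) (Pow {1..n})) f)"

definition simplicial_poset :: "'a set \<Rightarrow> ('a \<times> 'a) set \<Rightarrow> bool"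
  where "simplicial_poset A r \<longleftrightarrow>
    partial_order_on A r \<and> countable A \<and> has_finite_length r \<and>
    (\<exists>!m. minimal_in A r m) \<and>
    (\<forall>p\<in>A. boolean_poset {x \<in> A. (x, p) \<in> r} (Restr r {x \<in> A. (x, p) \<in> r}))"

text \<open>Built from \<^const>\<open>BijGroup\<close> in the same way as \<^const>\<open>AutoGroup\<close>.\<close>

definition order_AutoGroup :: "'a set \<Rightarrow> ('a \<times> 'a) set \<Rightarrow> ('a \<Rightarrow> 'a) monoid"
  where "order_AutoGroup A r = BijGroup A \<lparr>carrier := {f \<in> Bij A. order_iso A r A r f}\<rparr>"

lemma group_order_AutoGroup: "group (order_AutoGroup A r)"
proof -
  have "subgroup {f \<in> Bij A. order_iso A r A r f} (BijGroup A)"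
  proof (rule subgroup.intro)
    show "{f \<in> Bij A. order_iso A r A r f} \<subseteq> carrier (BijGroup A)"
      by (auto simp: BijGroup_def)
  next
    fix f g
    assume "f \<in> {f \<in> Bij A. order_iso A r A r f}" "g \<in> {f \<in> Bij A. order_iso A r A r f}"
    then have f: "f \<in> Bij A" "order_iso A r A r f" and g: "g \<in> Bij A" "order_iso A r A r g"
      by auto
    have "g x \<in> A" if "x \<in> A" for x
      using g(1) that by (auto simp: Bij_def bij_betw_def)
    with f g show "f \<otimes>\<^bsub>BijGroup A\<^esub> g \<in> {f \<in> Bij A. order_iso A r A r f}"
      using compose_Bij[OF f(1) g(1)]
      by (auto simp: BijGroup_def order_iso_def compose_eq Bij_def)
  next
    show "\<one>\<^bsub>BijGroup A\<^esub> \<in> {f \<in> Bij A. order_iso A r A r f}"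
      using id_Bij[of A] by (auto simp: BijGroup_def order_iso_def Bij_def)
  next
    fix f
    assume "f \<in> {f \<in> Bij A. order_iso A r A r f}"
    then have f: "f \<in> Bij A" "order_iso A r A r f" by auto
    have b: "bij_betw f A A" using f(1) by (auto simp: Bij_def)
    have i: "inv_into A f x \<in> A" "f (inv_into A f x) = x" if "x \<in> A" for x
      using that b by (auto simp: bij_betw_def inv_into_into f_inv_into_f)
    have "order_iso A r A r (\<lambda>x\<in>A. inv_into A f x)"
      unfolding order_iso_def
    proof (intro conjI ballI)
      show "bij_betw (\<lambda>x\<in>A. inv_into A f x) A A"
        using restrict_inv_into_Bij[OF f(1)] by (auto simp: Bij_def)
    next
      fix x y assume "x \<in> A" "y \<in> A"
      then show "((x, y) \<in> r) = (((\<lambda>x\<in>A. inv_into A f x) x, (\<lambda>x\<in>A. inv_into A f x) y) \<in> r)"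
        using f(2) i unfolding order_iso_def by (metis restrict_apply')
    qed
    then show "inv\<^bsub>BijGroup A\<^esub> f \<in> {f \<in> Bij A. order_iso A r A r f}"
      using restrict_inv_into_Bij[OF f(1)] by (simp add: inv_BijGroup f(1))
  qed
  then show ?thesis
    unfolding order_AutoGroup_def
    by (rule subgroup.subgroup_is_group[OF _ group_BijGroup])
qed

definition order_action ::
  "('g, 'm) monoid_scheme \<Rightarrow> 'a set \<Rightarrow> ('a \<times> 'a) set \<Rightarrow> ('g \<Rightarrow> 'a \<Rightarrow> 'a) \<Rightarrow> bool"
  where "order_action G A r \<phi> \<longleftrightarrow> group_hom G (order_AutoGroup A r) \<phi>"

definition quotient_order ::
  "('g, 'm) monoid_scheme \<Rightarrow> 'a set \<Rightarrow> ('a \<times> 'a) set \<Rightarrow> ('g \<Rightarrow> 'a \<Rightarrow> 'a) \<Rightarrow> ('a set \<times> 'a set) set"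
  where "quotient_order G A r \<phi> =
    {(orbit G \<phi> p, orbit G \<phi> q) | p q. p \<in> A \<and> q \<in> A \<and> (\<exists>g\<in>carrier G. (\<phi> g p, q) \<in> r)}"

definition translative ::
  "('g, 'm) monoid_scheme \<Rightarrow> 'a set \<Rightarrow> ('a \<times> 'a) set \<Rightarrow> ('g \<Rightarrow> 'a \<Rightarrow> 'a) \<Rightarrow> bool"
  where "translative G A r \<phi> \<longleftrightarrow>
    (\<forall>p\<in>A. \<forall>g\<in>carrier G. (\<exists>u\<in>A. (p, u) \<in> r \<and> (\<phi> g p, u) \<in> r) \<longrightarrow> p = \<phi> g p)"

lemma order_action_imp_group_action:
  assumes "order_action G A r \<phi>"
  shows "group_action G A \<phi>"
proof (rule group_action.intro)
  interpret group_hom G "order_AutoGroup A r" \<phi>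
    using assms by (simp add: order_action_def)
  have "\<phi> \<in> hom G (BijGroup A)"
    using homh by (auto simp: hom_def order_AutoGroup_def BijGroup_def)
  then show "group_hom G (BijGroup A) \<phi>"
    by (simp add: group_hom_def group_hom_axioms_def group_BijGroup)
qed

text \<open>The quotient relation does not depend on the chosen orbit representatives.\<close>

lemma quotient_order_iff:
  assumes act: "order_action G A r \<phi>" and p: "p \<in> A" and q: "q \<in> A"
  shows "(orbit G \<phi> p, orbit G \<phi> q) \<in> quotient_order G A r \<phi> \<longleftrightarrow>
    (\<exists>g\<in>carrier G. (\<phi> g p, q) \<in> r)"
proof
  interpret group_action G A \<phi>
    by (rule order_action_imp_group_action[OF act])
  interpret group_hom G "order_AutoGroup A r" \<phi>
    using act by (simp add: order_action_def)
  have mono: "(\<phi> g x, \<phi> g y) \<in> r" if "g \<in> carrier G" "x \<in> A" "y \<in> A" "(x, y) \<in> r" for g x y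
    using hom_closed[OF that(1)] that by (auto simp: order_AutoGroup_def order_iso_def)
  assume "(orbit G \<phi> p, orbit G \<phi> q) \<in> quotient_order G A r \<phi>"
  then obtain p' q' g where *: "orbit G \<phi> p = orbit G \<phi> p'" "orbit G \<phi> q = orbit G \<phi> q'"
      "p' \<in> A" "q' \<in> A" "g \<in> carrier G" "(\<phi> g p', q') \<in> r"
    by (auto simp: quotient_order_def)
  have "p' \<in> orbit G \<phi> p" "q \<in> orbit G \<phi> q'"
    using * orbit_refl p q by auto
  then obtain h k where hk: "h \<in> carrier G" "p' = \<phi> h p" "k \<in> carrier G" "q = \<phi> k q'"
    by (auto simp: orbit_def)
  have "\<phi> g p' \<in> A" using * element_image by blast
  then have "(\<phi> k (\<phi> g p'), q) \<in> r"
    using mono[OF hk(3) _ *(4) *(6)] hk(4) by simp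
  moreover have "\<phi> k (\<phi> g p') = \<phi> (k \<otimes>\<^bsub>G\<^esub> (g \<otimes>\<^bsub>G\<^esub> h)) p"
    using composition_rule p * hk by (simp del: hom_mult)
  ultimately show "\<exists>g\<in>carrier G. (\<phi> g p, q) \<in> r"
    using * hk by (metis G.m_closed)
qed (use p q in \<open>auto simp: quotient_order_def\<close>)

end

theory Submission
  imports Defs
begin

text \<open>
  For \<open>q \<in> P\<close> the projection maps \<open>P\<^bsub>\<le>q\<^esub>\<close> onto \<open>(P/G)\<^bsub>\<le>Gq\<^esub>\<close>, and translativity says that all
  these maps are injective; they are then order isomorphisms. Conversely, comparable elements of
  one orbit are equal, because their lower intervals are finite of the same size. So a chain of
  \<open>n + 1\<close> elements in \<open>P\<^bsub>\<le>q\<^esub> \<cong> 2\<^sup>n\<close> stays one in \<open>P/G\<close>, and if \<open>(P/G)\<^bsub>\<le>Gq\<^esub>\<close> is Boolean, then it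
  has at least \<open>2\<^sup>n\<close> elements, whence the projection is injective on \<open>P\<^bsub>\<le>q\<^esub>\<close>.
\<close>

section \<open>Boolean posets\<close>

lemma order_iso_comp:
  assumes "order_iso A r B s f" and "order_iso B s C t g"
  shows "order_iso A r C t (g \<circ> f)"
  using assms bij_betw_trans[of f A B g C] bij_betwE[of f A B]
  by (auto simp: order_iso_def)

lemma order_iso_inv_into:
  assumes "order_iso A r B s f"
  shows "order_iso B s A r (inv_into A f)"
  unfolding order_iso_def
proof (intro conjI ballI)
  have b: "bij_betw f A B" using assms by (simp add: order_iso_def)
  then show "bij_betw (inv_into A f) B A" by (rule bij_betw_inv_into)
  fix x y assume "x \<in> B" "y \<in> B"
  with b have "inv_into A f x \<in> A" "inv_into A f y \<in> A"
    "f (inv_into A f x) = x" "f (inv_into A f y) = y"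
    by (auto simp: bij_betw_def inv_into_into f_inv_into_f)
  with assms show "((x, y) \<in> s) = ((inv_into A f x, inv_into A f y) \<in> r)"
    unfolding order_iso_def by metis
qed

lemma boolean_poset_order_iso:
  assumes "order_iso A r B s f" and "boolean_poset A r"
  shows "boolean_poset B s"
  using assms order_iso_inv_into order_iso_comp unfolding boolean_poset_def by blast

lemma order_iso_Chains:
  assumes "order_iso A r B s f" and "C \<in> Chains r" and "C \<subseteq> A"
  shows "f ` C \<in> Chains s" "f ` C \<subseteq> B" "card (f ` C) = card C" "finite (f ` C) \<longleftrightarrow> finite C"
proof -
  have b: "bij_betw f A B" using assms(1) by (simp add: order_iso_def)
  show "f ` C \<in> Chains s"
    using assms unfolding order_iso_def Chains_def by blast
  show "f ` C \<subseteq> B"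
    using b assms(3) by (auto simp: bij_betw_def)
  have "inj_on f C"
    using b assms(3) by (auto simp: bij_betw_def intro: inj_on_subset)
  then show "card (f ` C) = card C" "finite (f ` C) \<longleftrightarrow> finite C"
    by (simp_all add: card_image finite_image_iff)
qed

text \<open>Nested finite sets of equal cardinality coincide, so \<open>card\<close> is injective on
  \<open>C\<close>; its values lie in \<open>{..card S}\<close>, which has \<open>card S + 1\<close>
  elements.\<close>

lemma card_chain_Pow_le:
  assumes "\<And>X Y. X \<in> C \<Longrightarrow> Y \<in> C \<Longrightarrow> X \<subseteq> Y \<or> Y \<subseteq> X" and "C \<subseteq> Pow S" and "finite S"
  shows "card C \<le> card S + 1"
proof -
  have fin: "finite X" if "X \<in> C" for X
    using that assms(2,3) by (meson PowD finite_subset subsetD)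
  have "inj_on card C"
    by (rule inj_onI) (metis assms(1) card_subset_eq fin)
  moreover have "card ` C \<subseteq> {..card S}"
    using assms(2,3) by (auto intro!: card_mono)
  ultimately show ?thesis
    using card_inj_on_le[of card C "{..card S}"] by simp
qed

text \<open>One number \<open>n\<close> governs both the cardinality and the longest chains, so a
  bound on chains becomes a bound on size and conversely. This form lets two Boolean posets be
  compared without handling their isomorphisms.\<close>

lemma boolean_posetE:
  assumes "boolean_poset B s"
  obtains n C m where "card B = 2 ^ n"
    and "C \<in> Chains s" "C \<subseteq> B" "card C = n + 1"
    and "\<And>D. D \<in> Chains s \<Longrightarrow> D \<subseteq> B \<Longrightarrow> card D \<le> n + 1"
    and "m \<in> B" "\<And>x. x \<in> B \<Longrightarrow> (m, x) \<in> s"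
proof -
  obtain n :: nat and f
    where f: "order_iso B s (Pow {1..n}) (relation_of (\<subseteq>) (Pow {1..n})) f"
    using assms by (auto simp: boolean_poset_def)
  define g where "g = inv_into B f"
  \<comment> \<open>The flag from the empty set (\<open>k = 0\<close>) up to \<open>{1..n}\<close>,
    hence \<open>n + 1\<close> members.\<close>
  define K where "K = (\<lambda>k. {1..k}) ` {..n}"
  have g: "order_iso (Pow {1..n}) (relation_of (\<subseteq>) (Pow {1..n})) B s g"
    unfolding g_def by (rule order_iso_inv_into[OF f])
  have "inj_on (\<lambda>k::nat. {1..k}) {..n}"
    by (rule inj_onI) (metis card_atLeastAtMost diff_Suc_1)
  then have cK: "card K = n + 1"
    by (simp add: K_def card_image)
  have K: "K \<in> Chains (relation_of (\<subseteq>) (Pow {1..n}))" "K \<subseteq> Pow {1..n}"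
    by (auto simp: K_def Chains_def relation_of_def)
  show ?thesis
  proof (rule that[of n "g ` K" "g {}"])
    show "card B = 2 ^ n"
      using g bij_betw_same_card[of g "Pow {1..n}" B] by (simp add: order_iso_def card_Pow)
    show "g ` K \<in> Chains s" "g ` K \<subseteq> B" "card (g ` K) = n + 1"
      using order_iso_Chains[OF g K] cK by auto
    show "card D \<le> n + 1" if D: "D \<in> Chains s" "D \<subseteq> B" for D
    proof -
      note img = order_iso_Chains[OF f D]
      have "card (f ` D) \<le> card {1..n} + 1"
        by (rule card_chain_Pow_le) (use img in \<open>auto simp: Chains_def relation_of_def\<close>)
      with img show ?thesis by simp
    qed
    show "g {} \<in> B"
      using g by (auto simp: order_iso_def bij_betw_def)
    fix x assume x: "x \<in> B"
    then obtain X where "X \<in> Pow {1..n}" "x = g X"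
      using g by (auto simp: order_iso_def bij_betw_def)
    then show "(g {}, x) \<in> s"
      using g by (auto simp: order_iso_def relation_of_def)
  qed
qed

section \<open>Group actions on simplicial posets\<close>

locale simplicial_action =
  fixes G :: "('g, 'm) monoid_scheme"
    and A :: "'a set"
    and r :: "('a \<times> 'a) set"
    and \<phi> :: "'g \<Rightarrow> 'a \<Rightarrow> 'a"
  assumes simplicial: "simplicial_poset A r"
    and order_action: "order_action G A r \<phi>"
begin

sublocale group_action G A \<phi>
  by (rule order_action_imp_group_action[OF order_action])

abbreviation lower :: "'a \<Rightarrow> 'a set"
  where "lower p \<equiv> {x \<in> A. (x, p) \<in> r}"

abbreviation proj :: "'a \<Rightarrow> 'a set"
  where "proj \<equiv> orbit G \<phi>"

abbreviation qorder :: "('a set \<times> 'a set) set"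
  where "qorder \<equiv> quotient_order G A r \<phi>"

abbreviation qlower :: "'a set \<Rightarrow> 'a set set"
  where "qlower u \<equiv> {v \<in> orbits G A \<phi>. (v, u) \<in> qorder}"

section \<open>Order, action and projection to orbits\<close>

lemma po: "partial_order_on A r"
  using simplicial by (simp add: simplicial_poset_def)

lemma refl: "p \<in> A \<Longrightarrow> (p, p) \<in> r"
  using po by (auto simp: partial_order_on_def preorder_on_def refl_on_def)

lemma trans: "(x, y) \<in> r \<Longrightarrow> (y, z) \<in> r \<Longrightarrow> (x, z) \<in> r"
  using po by (auto simp: partial_order_on_def preorder_on_def dest: transD)

lemma antisym: "(x, y) \<in> r \<Longrightarrow> (y, x) \<in> r \<Longrightarrow> x = y"
  using po by (auto simp: partial_order_on_def dest: antisymD)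

lemma act_closed: "g \<in> carrier G \<Longrightarrow> x \<in> A \<Longrightarrow> \<phi> g x \<in> A"
  using element_image by blast

lemma act_mono_iff:
  assumes "g \<in> carrier G" "x \<in> A" "y \<in> A"
  shows "(\<phi> g x, \<phi> g y) \<in> r \<longleftrightarrow> (x, y) \<in> r"
proof -
  interpret group_hom G "order_AutoGroup A r" \<phi>
    using order_action by (simp add: order_action_def)
  show ?thesis
    using hom_closed[OF assms(1)] assms by (auto simp: order_AutoGroup_def order_iso_def)
qed

lemma proj_le_iff:
  "p \<in> A \<Longrightarrow> q \<in> A \<Longrightarrow> (proj p, proj q) \<in> qorder \<longleftrightarrow> (\<exists>g\<in>carrier G. (\<phi> g p, q) \<in> r)"
  by (rule quotient_order_iff[OF order_action])

lemma proj_eqD: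
  assumes "p \<in> A" "q \<in> A" "proj p = proj q"
  obtains g where "g \<in> carrier G" "q = \<phi> g p"
  using orbit_refl[OF assms(2)] assms(3) by (auto simp: orbit_def)

lemma proj_mono:
  assumes "p \<in> A" "q \<in> A" "(p, q) \<in> r"
  shows "(proj p, proj q) \<in> qorder"
proof -
  \<comment> \<open>The order on orbits asks for a group element; any one that fixes
    \<open>p\<close> serves.\<close>
  obtain g where "g \<in> carrier G" "p = \<phi> g p"
    using proj_eqD[OF assms(1,1)] by blast
  with assms(3) have "\<exists>g\<in>carrier G. (\<phi> g p, q) \<in> r" by metis
  with assms show ?thesis by (simp add: proj_le_iff)
qed

lemma proj_act:
  assumes "g \<in> carrier G" "p \<in> A"
  shows "proj (\<phi> g p) = proj p"
proof -
  have "\<phi> g p \<in> proj p" using assms by (auto simp: orbit_def)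
  then show ?thesis
    using orbit_sym_aux[OF assms] disjoint_union[of "proj p" "proj (\<phi> g p)"]
      orbit_refl[OF act_closed[OF assms]] assms act_closed[OF assms]
    unfolding orbits_def by blast
qed

lemma orbitsE:
  assumes "u \<in> orbits G A \<phi>"
  obtains p where "p \<in> A" "u = proj p"
  using assms by (auto simp: orbits_def)

lemma proj_in_orbits: "p \<in> A \<Longrightarrow> proj p \<in> orbits G A \<phi>"
  by (auto simp: orbits_def)

section \<open>Lower intervals and their sizes\<close>

lemma boolean_lower: "p \<in> A \<Longrightarrow> boolean_poset (lower p) (Restr r (lower p))"
  using simplicial by (simp add: simplicial_poset_def)

text \<open>The cardinality is a power of 2, hence positive, while \<open>card\<close> is 0 on
  infinite sets.\<close>

lemma finite_lower: "p \<in> A \<Longrightarrow> finite (lower p)"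
  by (rule card_ge_0_finite, erule boolean_posetE[OF boolean_lower]) simp

lemma card_lower_act:
  assumes "g \<in> carrier G" "p \<in> A"
  shows "card (lower (\<phi> g p)) = card (lower p)"
proof -
  have "\<phi> g ` lower p = lower (\<phi> g p)"
  proof (intro equalityI subsetI)
    fix y assume y: "y \<in> lower (\<phi> g p)"
    with assms obtain x where "x \<in> A" "y = \<phi> g x"
      using surj_prop by blast
    with y assms show "y \<in> \<phi> g ` lower p"
      by (auto simp: act_mono_iff)
  qed (use assms in \<open>auto simp: act_mono_iff act_closed\<close>)
  moreover have "inj_on (\<phi> g) (lower p)"
    using inj_prop[OF assms(1)] by (rule inj_on_subset) auto
  ultimately show ?thesis using card_image by fastforce
qed

lemma card_lower_proj:
  assumes "p \<in> A" "q \<in> A" "proj p = proj q"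
  shows "card (lower p) = card (lower q)"
proof -
  obtain g where "g \<in> carrier G" "q = \<phi> g p"
    by (rule proj_eqD[OF assms])
  with assms(1) show ?thesis by (simp add: card_lower_act)
qed

text \<open>As \<open>lower p\<close> is contained in the finite set \<open>lower q\<close>, the
  size bound makes them equal, and so \<open>q\<close> is below \<open>p\<close>. Thus the size of
  the lower interval is a strictly increasing rank; by \<open>card_lower_proj\<close> it is constant
  on orbits.\<close>

lemma le_card_lower_eq:
  assumes "p \<in> A" "q \<in> A" "(p, q) \<in> r" "card (lower q) \<le> card (lower p)"
  shows "p = q"
proof -
  have "lower p \<subseteq> lower q"
    using assms(3) by (auto intro: trans)
  with assms have "lower p = lower q"
    by (intro card_seteq finite_lower)
  with assms refl have "(q, p) \<in> r" by blast
  with assms(3) show ?thesis by (rule antisym)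
qed

text \<open>An interval of size \<open>2 ^ n\<close> contains a chain of \<open>n + 1\<close>
  elements, so the length of the poset bounds \<open>n\<close>. The resulting uniform bound on ranks
  yields the finite length of the quotient.\<close>

lemma card_lower_bounded: "\<exists>N. \<forall>p\<in>A. card (lower p) \<le> N"
proof -
  obtain l where l: "\<And>C. C \<in> Chains r \<Longrightarrow> card C \<le> l + 1"
    using simplicial by (auto simp: simplicial_poset_def has_finite_length_def)
  have "card (lower p) \<le> 2 ^ l" if p: "p \<in> A" for p
  proof (rule boolean_posetE[OF boolean_lower[OF p]])
    fix n C
    assume n: "card (lower p) = 2 ^ n" "card C = n + 1" "C \<in> Chains (Restr r (lower p))"
    then have "C \<in> Chains r" by (auto simp: Chains_def)
    with n l have "n \<le> l" by fastforce
    with n show ?thesis by simp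
  qed
  then show ?thesis by blast
qed

text \<open>The bottom of each Boolean interval is minimal in the whole poset, since everything
  below it lies in the same interval; uniqueness of the minimal element makes all these bottoms
  coincide.\<close>

lemma least_exists: "\<exists>m\<in>A. \<forall>p\<in>A. (m, p) \<in> r"
proof -
  obtain z where z: "minimal_in A r z" "\<And>x. minimal_in A r x \<Longrightarrow> x = z"
    using simplicial unfolding simplicial_poset_def by blast
  have "(z, p) \<in> r" if p: "p \<in> A" for p
  proof (rule boolean_posetE[OF boolean_lower[OF p]])
    fix m
    assume m: "m \<in> lower p" "\<And>x. x \<in> lower p \<Longrightarrow> (m, x) \<in> Restr r (lower p)"
    have "minimal_in A r m"
      unfolding minimal_in_def
      using m trans antisym by blast
    with z m show ?thesis by auto
  qed
  then show ?thesis
    using z(1) unfolding minimal_in_def by blast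
qed

section \<open>The projection on lower intervals\<close>

lemma proj_image_lower:
  assumes "q \<in> A"
  shows "proj ` lower q = qlower (proj q)"
proof (intro equalityI subsetI)
  fix u assume u: "u \<in> qlower (proj q)"
  then obtain p where p: "p \<in> A" "u = proj p" by (auto elim: orbitsE)
  \<comment> \<open>The translate \<open>\<phi> g p\<close> is a representative of \<open>u\<close>
    that lies below \<open>q\<close> itself.\<close>
  with u assms obtain g where "g \<in> carrier G" "(\<phi> g p, q) \<in> r"
    by (auto simp: proj_le_iff)
  with p show "u \<in> proj ` lower q"
    by (intro image_eqI[of _ _ "\<phi> g p"]) (auto simp: proj_act act_closed)
qed (use assms in \<open>auto simp: proj_mono proj_in_orbits\<close>)

lemma inj_on_proj_if_boolean:
  assumes q: "q \<in> A" and "boolean_poset (qlower (proj q)) (Restr qorder (qlower (proj q)))"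
  shows "inj_on proj (lower q)"
proof (rule boolean_posetE[OF boolean_lower[OF q]], rule boolean_posetE[OF assms(2)])
  fix n C k
  assume C: "card (lower q) = 2 ^ n" "C \<in> Chains (Restr r (lower q))" "C \<subseteq> lower q" "card C = n + 1"
  assume k: "card (qlower (proj q)) = 2 ^ k"
    "\<And>D. D \<in> Chains (Restr qorder (qlower (proj q))) \<Longrightarrow> D \<subseteq> qlower (proj q) \<Longrightarrow> card D \<le> k + 1"
  \<comment> \<open>Two members of \<open>C\<close> in one orbit are comparable and of equal rank,
    hence equal.\<close>
  have "inj_on proj C"
  proof (rule inj_onI)
    fix x y assume xy: "x \<in> C" "y \<in> C" "proj x = proj y"
    with C have "x \<in> A" "y \<in> A" "(x, y) \<in> r \<or> (y, x) \<in> r"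
      by (auto simp: Chains_def)
    moreover from this xy have "card (lower x) = card (lower y)"
      by (intro card_lower_proj)
    ultimately show "x = y"
      using le_card_lower_eq[of x y] le_card_lower_eq[of y x] by auto
  qed
  then have "card (proj ` C) = n + 1" using C by (simp add: card_image)
  moreover have sub: "proj ` C \<subseteq> qlower (proj q)"
    using C proj_image_lower[OF q] by blast
  moreover have "proj ` C \<in> Chains (Restr qorder (qlower (proj q)))"
  proof -
    have "(proj x, proj y) \<in> qorder \<or> (proj y, proj x) \<in> qorder" if "x \<in> C" "y \<in> C" for x y
      using that C(2,3) proj_mono unfolding Chains_def by blast
    with sub show ?thesis unfolding Chains_def by blast
  qed
  \<comment> \<open>The image of \<open>C\<close> is a chain of \<open>n + 1\<close> elements in a
    Boolean poset of size \<open>2 ^ k\<close>. So the image of \<open>lower q\<close> has at least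
    \<open>2 ^ n\<close> elements, and no two elements of this finite set are identified.\<close>
  ultimately have "n \<le> k" using k(2) by fastforce
  then have "card (lower q) \<le> card (proj ` lower q)"
    using C(1) k(1) proj_image_lower[OF q] by simp
  with finite_lower[OF q] show ?thesis
    by (intro eq_card_imp_inj_on antisym_conv[THEN iffD1] card_image_le) auto
qed

text \<open>Both \<open>p\<close> and \<open>\<phi> g p\<close> lie below the common upper bound and
  share an orbit, so injectivity of the projection there identifies them.\<close>

lemma translative_if_simplicial_quotient:
  assumes "simplicial_poset (orbits G A \<phi>) qorder"
  shows "translative G A r \<phi>"
  unfolding translative_def
proof (intro ballI impI)
  fix p g assume p: "p \<in> A" and g: "g \<in> carrier G"
    and "\<exists>u\<in>A. (p, u) \<in> r \<and> (\<phi> g p, u) \<in> r"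
  then obtain q where q: "q \<in> A" "(p, q) \<in> r" "(\<phi> g p, q) \<in> r" by blast
  have "inj_on proj (lower q)"
    using assms q(1) proj_in_orbits
    by (intro inj_on_proj_if_boolean) (auto simp: simplicial_poset_def)
  then show "p = \<phi> g p"
    using p g q act_closed proj_act[OF g p] by (auto dest: inj_onD)
qed

section \<open>The quotient by a translative action\<close>

lemma simplicial_quotient_if_translative:
  assumes "translative G A r \<phi>"
  shows "simplicial_poset (orbits G A \<phi>) qorder"
proof -
  have tr: "\<phi> g p = p" if "p \<in> A" "g \<in> carrier G" "(p, u) \<in> r" "(\<phi> g p, u) \<in> r" "u \<in> A" for p g u
    using assms that unfolding translative_def by metis
  \<comment> \<open>Inside an interval the projection reflects the order: a translate of
    \<open>x\<close> below \<open>y\<close> is also below \<open>q\<close>, which bounds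
    \<open>x\<close> too, so translativity removes the group element.\<close>
  have lift: "(x, y) \<in> r"
    if q: "q \<in> A" and xy: "x \<in> lower q" "y \<in> lower q" and le: "(proj x, proj y) \<in> qorder"
    for q x y
  proof -
    obtain g where g: "g \<in> carrier G" "(\<phi> g x, y) \<in> r"
      using le xy by (auto simp: proj_le_iff)
    with xy have "(\<phi> g x, q) \<in> r" by (auto intro: trans)
    with g xy q have "\<phi> g x = x" by (intro tr[of x g q]) auto
    with g show ?thesis by simp
  qed
  have iso: "order_iso (lower q) (Restr r (lower q))
      (qlower (proj q)) (Restr qorder (qlower (proj q))) proj" if q: "q \<in> A" for q
    unfolding order_iso_def
  proof (intro conjI ballI)
    \<comment> \<open>Two elements of one orbit below \<open>q\<close> have \<open>q\<close> as
      upper bound, so translativity equates them.\<close>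
    have "inj_on proj (lower q)"
      by (rule inj_onI) (use q tr in \<open>force elim: proj_eqD\<close>)
    then show "bij_betw proj (lower q) (qlower (proj q))"
      using proj_image_lower[OF q] by (simp add: bij_betw_def)
    fix x y assume xy: "x \<in> lower q" "y \<in> lower q"
    have "(x, y) \<in> r \<longleftrightarrow> (proj x, proj y) \<in> qorder"
      using lift[OF q xy] xy proj_mono by blast
    then show "((x, y) \<in> Restr r (lower q)) =
        ((proj x, proj y) \<in> Restr qorder (qlower (proj q)))"
      using xy proj_image_lower[OF q] by blast
  qed
  have qsub: "qorder \<subseteq> orbits G A \<phi> \<times> orbits G A \<phi>"
    by (auto simp: quotient_order_def orbits_def)
  have qantisym: "proj p = proj q"
    if pq: "p \<in> A" "q \<in> A" "(proj p, proj q) \<in> qorder" "(proj q, proj p) \<in> qorder" for p q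
  proof -
    obtain g where g: "g \<in> carrier G" "(\<phi> g p, q) \<in> r"
      using pq by (auto simp: proj_le_iff)
    \<comment> \<open>Replacing \<open>p\<close> by its translate puts both representatives below
      \<open>q\<close>, where \<open>lift\<close> turns the reverse comparison of orbits into one in
      the poset.\<close>
    have mem: "proj (\<phi> g p) = proj p" "\<phi> g p \<in> lower q" "q \<in> lower q"
      using pq g refl by (auto simp: proj_act act_closed)
    then have "(q, \<phi> g p) \<in> r"
      using pq by (intro lift[of q]) auto
    with g have "q = \<phi> g p" by (auto intro: antisym)
    with mem show ?thesis by simp
  qed
  have po_q: "partial_order_on (orbits G A \<phi>) qorder"
    unfolding partial_order_on_def preorder_on_def
  proof (intro conjI)
    show "qorder \<subseteq> orbits G A \<phi> \<times> orbits G A \<phi>" by (rule qsub)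
    show "refl_on (orbits G A \<phi>) qorder"
      by (rule refl_onI) (auto elim!: orbitsE intro: proj_mono refl)
    show "antisym qorder"
      by (rule antisymI) (use qsub qantisym in \<open>force elim!: orbitsE\<close>)
    show "trans qorder"
    proof (rule transI)
      fix u v w assume uv: "(u, v) \<in> qorder" and vw: "(v, w) \<in> qorder"
      \<comment> \<open>Representatives are chosen from the top down, each below the previous one,
        so that transitivity of \<open>r\<close> applies directly.\<close>
      with qsub obtain p where p: "w = proj p" "p \<in> A" by (blast elim: orbitsE)
      with vw qsub obtain q where q: "q \<in> lower p" "v = proj q"
        using proj_image_lower[OF p(2)] by blast
      with uv qsub obtain x where "x \<in> lower q" "u = proj x"
        using proj_image_lower[of q] by blast
      with p q show "(u, w) \<in> qorder"
        by (auto intro: proj_mono trans)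
    qed
  qed
  have fl: "has_finite_length qorder"
  proof -
    obtain N where N: "\<And>p. p \<in> A \<Longrightarrow> card (lower p) \<le> N"
      using card_lower_bounded by blast
    have "finite C \<and> card C \<le> N + 1" if C: "C \<in> Chains qorder" for C
    proof -
      \<comment> \<open>The rank of an orbit, read off an arbitrary representative. It is injective
        on a chain with values in \<open>{..N}\<close>, whence the bound
        \<open>N + 1\<close>.\<close>
      define h where "h u = card (lower (inv_into A proj u))" for u
      have h: "h (proj p) = card (lower p)" if "p \<in> A" for p
        using that f_inv_into_f[of "proj p" proj A] inv_into_into[of "proj p" proj A]
        by (auto simp: h_def intro: card_lower_proj)
      have C_orb: "C \<subseteq> orbits G A \<phi>"
        using C qsub unfolding Chains_def by blast
      have eq: "u = v" if "(u, v) \<in> qorder" "h u = h v" for u v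
      proof -
        obtain q where q: "q \<in> A" "v = proj q"
          using \<open>(u, v) \<in> qorder\<close> qsub by (blast elim: orbitsE)
        then obtain p where "p \<in> lower q" "u = proj p"
          using \<open>(u, v) \<in> qorder\<close> qsub proj_image_lower[of q] by blast
        with q that h show ?thesis
          using le_card_lower_eq[of p q] by auto
      qed
      have "inj_on h C"
        by (rule inj_onI) (use C eq in \<open>force simp: Chains_def\<close>)
      moreover have "h ` C \<subseteq> {..N}"
        using C_orb h N by (force elim: orbitsE)
      ultimately show ?thesis
        using inj_on_finite[of h C "{..N}"] card_inj_on_le[of h C "{..N}"] by simp
    qed
    then show ?thesis unfolding has_finite_length_def by blast
  qed
  have min: "\<exists>!m. minimal_in (orbits G A \<phi>) qorder m"
  proof -
    \<comment> \<open>The orbit of the least element is least in the quotient, and a least element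
      is the only minimal one.\<close>
    obtain z where z: "z \<in> A" "\<And>p. p \<in> A \<Longrightarrow> (z, p) \<in> r"
      using least_exists by blast
    then have least: "(proj z, u) \<in> qorder" if "u \<in> orbits G A \<phi>" for u
      using that by (auto elim!: orbitsE intro: proj_mono)
    have "minimal_in (orbits G A \<phi>) qorder (proj z)"
      using least po_q z(1) proj_in_orbits
      by (auto simp: minimal_in_def partial_order_on_def dest: antisymD)
    moreover have "u = proj z" if "minimal_in (orbits G A \<phi>) qorder u" for u
      using that least z(1) proj_in_orbits by (auto simp: minimal_in_def)
    ultimately show ?thesis by blast
  qed
  have "orbits G A \<phi> = proj ` A" by (auto simp: orbits_def)
  then have "countable (orbits G A \<phi>)"
    using simplicial by (simp add: simplicial_poset_def)
  moreover have "boolean_poset (qlower u) (Restr qorder (qlower u))" if "u \<in> orbits G A \<phi>" for u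
    using that iso boolean_lower by (blast elim: orbitsE intro: boolean_poset_order_iso)
  ultimately show ?thesis
    using po_q fl min by (simp add: simplicial_poset_def)
qed

end

theorem lemma3p5:
  fixes G :: "('g, 'm) monoid_scheme"
    and A :: "'a set"
    and r :: "('a \<times> 'a) set"
    and \<phi> :: "'g \<Rightarrow> 'a \<Rightarrow> 'a"
  assumes "simplicial_poset A r"
    and "order_action G A r \<phi>"
  shows "simplicial_poset (orbits G A \<phi>) (quotient_order G A r \<phi>) \<longleftrightarrow> translative G A r \<phi>"
proof -
  interpret simplicial_action G A r \<phi>
    using assms by unfold_locales
  show ?thesis
    using translative_if_simplicial_quotient simplicial_quotient_if_translative by blast
qed

end
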